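(* Let $\mathbb H_n$ be an $n$-dimensional Hilbert space with orthonormal basis $\{g_i\}_{i=1}^n$. If $T:\mathbb H_n\to\mathbb H_n$ is any bounded linear operator with $\|T\|=1$, then there is a containing Hilbert space $\mathbb H_n\subset\ell_2^M$ with $M=2n-1$ and an orthonormal basis $\{e_i\}_{i=1}^M$ of $\ell_2^M$ such that the orthogonal projection $P$ from $\ell_2^M$ onto $\mathbb H_n$ satisfies $$Pe_i=Tg_i\quad\text{for all } i=1,2,\dots,n.$$
   Context: $\ell_2^M$ denotes an $M$-dimensional complex Hilbert space. "Containing Hilbert space" means that $\mathbb H_n$ is (isometrically identified with) a linear subspace of $\ell_2^M$. *)

theory Defs
  imports "HOL-Analysis.Operator_Norm" "Jordan_Normal_Form.VS_Connect"
begin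

text \<open>
  Abstract complex inner product spaces, with the inner product linear in the first argument
  (the convention of \<open>\<bullet>c\<close> on complex vectors).  The class extends \<^class>\<open>real_normed_vector\<close>,
  so that \<^const>\<open>norm\<close>, \<^const>\<open>bounded_linear\<close> and \<^const>\<open>onorm\<close> are available; the complex scalar
  multiplication restricts to the real one and the norm is the one induced by the inner product.
\<close>

class complex_inner = real_normed_vector +
  fixes scaleC :: "complex \<Rightarrow> 'a \<Rightarrow> 'a"
    and cinner :: "'a \<Rightarrow> 'a \<Rightarrow> complex"
  assumes scaleC_add_right: "scaleC c (x + y) = scaleC c x + scaleC c y"
    and scaleC_add_left: "scaleC (c + d) x = scaleC c x + scaleC d x"
    and scaleC_scaleC: "scaleC c (scaleC d x) = scaleC (c * d) x"
    and scaleC_one: "scaleC 1 x = x"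
    and scaleC_of_real: "scaleC (complex_of_real r) x = r *\<^sub>R x"
    and cinner_commute: "cinner x y = cnj (cinner y x)"
    and cinner_add_left: "cinner (x + y) z = cinner x z + cinner y z"
    and cinner_scaleC_left: "cinner (scaleC c x) y = c * cinner x y"
    and cinner_ge_zero: "0 \<le> Re (cinner x x)"
    and cinner_eq_zero_iff: "cinner x x = 0 \<longleftrightarrow> x = 0"
    and norm_eq_sqrt_cinner: "norm x = sqrt (Re (cinner x x))"

class complex_hilbert_space = complex_inner + complete_space

global_interpretation complex_vector:
  vector_space "scaleC :: complex \<Rightarrow> 'a \<Rightarrow> 'a :: complex_inner"
  defines cspan = complex_vector.span
    and cdim = complex_vector.dim
  by unfold_locales (auto simp: scaleC_add_right scaleC_add_left scaleC_scaleC scaleC_one)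

definition bounded_clinear :: "('a::complex_inner \<Rightarrow> 'b::complex_inner) \<Rightarrow> bool" where
  "bounded_clinear T \<longleftrightarrow> bounded_linear T \<and> (\<forall>c x. T (scaleC c x) = scaleC c (T x))"

definition orthonormal_basis :: "nat \<Rightarrow> (nat \<Rightarrow> 'a::complex_inner) \<Rightarrow> bool" where
  "orthonormal_basis n g \<longleftrightarrow>
     (\<forall>i\<in>{1..n}. \<forall>j\<in>{1..n}. cinner (g i) (g j) = (if i = j then 1 else 0)) \<and>
     cspan (g ` {1..n}) = UNIV"

text \<open>
  The space \<open>\<ell>\<^sub>2\<^sup>M\<close> is \<^term>\<open>carrier_vec M :: complex vec set\<close> with the Hermitian inner product \<open>\<bullet>c\<close>.
\<close>

definition orthonormal_basis_l2 :: "nat \<Rightarrow> (nat \<Rightarrow> complex vec) \<Rightarrow> bool" where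
  "orthonormal_basis_l2 M e \<longleftrightarrow>
     (\<forall>i\<in>{1..M}. \<forall>j\<in>{1..M}. e i \<bullet>c e j = (if i = j then 1 else 0)) \<and>
     vectorspace.basis class_ring (module_vec TYPE(complex) M) (e ` {1..M})"

text \<open>
  An identification of a complex inner product space with a linear subspace of \<open>\<ell>\<^sub>2\<^sup>M\<close>,
  namely the range of \<open>J\<close>.
\<close>

definition isometric_embedding :: "nat \<Rightarrow> ('a::complex_inner \<Rightarrow> complex vec) \<Rightarrow> bool" where
  "isometric_embedding M J \<longleftrightarrow>
     (\<forall>x. J x \<in> carrier_vec M) \<and>
     (\<forall>x y. J (x + y) = J x + J y) \<and>
     (\<forall>c x. J (scaleC c x) = c \<cdot>\<^sub>v J x) \<and>
     (\<forall>x y. J x \<bullet>c J y = cinner x y)"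

text \<open>
  \<open>P\<close> is the orthogonal projection from \<open>\<ell>\<^sub>2\<^sup>M\<close> onto the linear subspace \<open>W\<close>; this determines
  \<open>P\<close> on \<^term>\<open>carrier_vec M\<close>, and nothing is said about its values elsewhere.
\<close>

definition orthogonal_projection ::
  "nat \<Rightarrow> complex vec set \<Rightarrow> (complex vec \<Rightarrow> complex vec) \<Rightarrow> bool" where
  "orthogonal_projection M W P \<longleftrightarrow>
     (\<forall>x\<in>carrier_vec M. P x \<in> W \<and> (\<forall>w\<in>W. (x - P x) \<bullet>c w = 0))"

end

theory Submission
  imports Defs "HOL-Analysis.Elementary_Metric_Spaces"
begin

text \<open>
  The key observation is that the basis of \<open>\<ell>\<^sub>2\<^sup>M\<close> can be taken to be the standard one, so that
  only the copy of the given space inside \<open>\<ell>\<^sub>2\<^sup>M\<close> has to be constructed.  If \<open>u\<^sub>1, \<dots>, u\<^sub>M\<close> is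
  a Parseval frame, that is, \<open>\<langle>x, y\<rangle> = \<Sum>\<^sub>k \<langle>x, u\<^sub>k\<rangle> \<langle>u\<^sub>k, y\<rangle>\<close> for all \<open>x\<close> and \<open>y\<close>, then the
  analysis map \<open>J x = (\<langle>x, u\<^sub>k\<rangle>)\<^sub>k\<close> is isometric, \<open>J J\<^sup>*\<close> is the projection onto its range, and
  \<open>J\<^sup>*\<close> sends the \<open>k\<close>-th unit vector to \<open>u\<^sub>k\<close>
  (\<open>Parseval_frame_dilation\<close>).  It remains to complete \<open>T g\<^sub>1, \<dots>, T g\<^sub>n\<close> to a Parseval frame with
  only \<open>n - 1\<close> further vectors.

  Since \<open>\<Sum>\<^sub>i \<langle>x, T g\<^sub>i\<rangle> \<langle>T g\<^sub>i, y\<rangle> = \<langle>T\<^sup>* x, T\<^sup>* y\<rangle>\<close>, the further vectors have to represent the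
  defect form \<open>q(x, y) = \<langle>x, y\<rangle> - \<langle>T\<^sup>* x, T\<^sup>* y\<rangle>\<close> as a sum of \<open>n - 1\<close> rank-one terms.  The bound
  \<open>\<parallel>T\<parallel> \<le> 1\<close> makes \<open>q\<close> positive semidefinite.  The equality \<open>\<parallel>T\<parallel> = 1\<close> makes it degenerate: by
  compactness of the unit sphere the norm is attained at a unit vector \<open>x\<close> (\<open>onorm_attained\<close>), and
  then \<open>\<parallel>T\<^sup>* T x\<parallel> \<ge> \<langle>T\<^sup>* T x, x\<rangle> = 1\<close>, so \<open>q\<close> vanishes at \<open>T x\<close>.  A positive semidefinite form is
  reduced to zero by successively subtracting rank-one squares, one for each vector of a complement
  of its radical (\<open>positive_form_sum_of_squares\<close>), and here this complement has dimension at most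
  \<open>n - 1\<close>.
\<close>

section \<open>Positive semidefinite Hermitian forms\<close>

definition positive_form :: "('a::complex_inner \<Rightarrow> 'a \<Rightarrow> complex) \<Rightarrow> bool" where
  "positive_form q \<longleftrightarrow>
     (\<forall>x y z. q (x + y) z = q x z + q y z) \<and>
     (\<forall>c x y. q (scaleC c x) y = c * q x y) \<and>
     (\<forall>x y. q y x = cnj (q x y)) \<and>
     (\<forall>x. 0 \<le> Re (q x x))"

lemma positive_formD:
  assumes "positive_form q"
  shows "q (x + y) z = q x z + q y z" "q (scaleC c x) y = c * q x y"
    and "q y x = cnj (q x y)" "0 \<le> Re (q x x)"
  using assms unfolding positive_form_def by blast+

lemma positive_form_right:
  assumes q: "positive_form q"
  shows "q x (y + z) = q x y + q x z" "q x (scaleC c y) = cnj c * q x y"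
  using positive_formD(1)[OF q, of y z x] positive_formD(2)[OF q, of c y x]
    positive_formD(3)[OF q, of x y] positive_formD(3)[OF q, of x z]
    positive_formD(3)[OF q, of x "y + z"] positive_formD(3)[OF q, of x "scaleC c y"]
  by (metis complex_cnj_add complex_cnj_cnj complex_cnj_mult)+

lemma positive_form_diag:
  assumes "positive_form q"
  shows "q x x = complex_of_real (Re (q x x))"
  using positive_formD(3)[OF assms, of x x] by (simp add: complex_eq_iff)

text \<open>
  With \<open>c = - s q(x, y)\<close> for real \<open>s\<close>, nonnegativity of \<open>q\<close> at \<open>x + c y\<close> is a real quadratic
  inequality in \<open>s\<close>; as \<open>q\<close> may be degenerate, its leading coefficient may vanish.
\<close>

lemma positive_form_Cauchy_Schwarz:
  assumes q: "positive_form q"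
  shows "(cmod (q x y))\<^sup>2 \<le> Re (q x x) * Re (q y y)"
proof -
  define r where "r = cmod (q x y)"
  define a where "a = Re (q y y)"
  note D = positive_formD[OF q] positive_form_right[OF q]
  have a0: "0 \<le> a" using D(4) by (simp add: a_def)
  have quad: "0 \<le> Re (q x x) - 2 * s * r\<^sup>2 + s\<^sup>2 * r\<^sup>2 * a" for s :: real
  proof -
    define c where "c = - (complex_of_real s * q x y)"
    have "q (x + scaleC c y) (x + scaleC c y)
        = q x x + cnj c * q x y + c * cnj (q x y) + c * cnj c * q y y"
      using D(3)[of x y] by (simp add: D(1,2,5,6) algebra_simps)
    also have "\<dots> = q x x - complex_of_real (2 * s * r\<^sup>2) + complex_of_real (s\<^sup>2 * r\<^sup>2 * a)"
    proof -
      have r2: "complex_of_real (r\<^sup>2) = q x y * cnj (q x y)"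
        unfolding r_def by (rule complex_norm_square)
      have yy: "q y y = complex_of_real a" unfolding a_def by (rule positive_form_diag[OF q])
      show ?thesis unfolding of_real_mult r2 yy by (simp add: c_def power2_eq_square algebra_simps)
    qed
    finally show ?thesis
      using D(4)[of "x + scaleC c y"] by (metis Re_complex_of_real minus_complex.sel(1) plus_complex.sel(1))
  qed
  show ?thesis
  proof (cases "a = 0")
    case True
    \<comment> \<open>The quadratic is then affine in the parameter, so its slope vanishes.\<close>
    have "r\<^sup>2 = 0"
    proof (rule ccontr)
      assume "r\<^sup>2 \<noteq> 0"
      then show False
        using quad[of "(Re (q x x) + 1) / r\<^sup>2"] True D(4)[of x] by simp
    qed
    then show ?thesis using True by (simp add: r_def a_def)
  next
    case False
    then have "0 < a" using a0 by simp
    \<comment> \<open>The parameter at which the quadratic is minimal.\<close>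
    then have "0 \<le> Re (q x x) - r\<^sup>2 / a"
      using quad[of "1 / a"] by (simp add: power2_eq_square)
    then show ?thesis
      using \<open>0 < a\<close> by (simp add: r_def[symmetric] a_def[symmetric] field_simps)
  qed
qed

lemma positive_form_null:
  assumes "positive_form q" "Re (q v v) \<le> 0"
  shows "q x v = 0"
proof -
  have "Re (q v v) = 0" using assms(2) positive_formD(4)[OF assms(1), of v] by simp
  then show ?thesis using positive_form_Cauchy_Schwarz[OF assms(1), of x v] by simp
qed

definition clinear_functional :: "('a::complex_inner \<Rightarrow> complex) \<Rightarrow> bool" where
  "clinear_functional f \<longleftrightarrow>
     (\<forall>x y. f (x + y) = f x + f y) \<and> (\<forall>c x. f (scaleC c x) = c * f x)"

text \<open>
  For a Hermitian form the left and the right radical coincide; the right one is the one named here.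
\<close>

definition radical :: "('a::complex_inner \<Rightarrow> 'a \<Rightarrow> complex) \<Rightarrow> 'a set" where
  "radical q = {v. \<forall>x. q x v = 0}"

lemma subspace_radical:
  assumes q: "positive_form q"
  shows "complex_vector.subspace (radical q)"
proof (rule complex_vector.subspaceI)
  have "q x 0 = 0" for x
    using positive_form_right(1)[OF q, of x 0 0] by simp
  then show "0 \<in> radical q" by (simp add: radical_def)
qed (auto simp: radical_def positive_form_right[OF q])

text \<open>
  One step of the Cholesky decomposition: subtracting the square of \<open>q(\<cdot>, v) / \<surd>q(v, v)\<close> puts
  \<open>v\<close> into the radical, and positivity survives by the Cauchy--Schwarz inequality.  The statement
  also covers \<open>q(v, v) = 0\<close>: division by zero then makes the functional zero, and \<open>v\<close> already
  lies in the radical.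
\<close>

lemma positive_form_deflate:
  fixes v :: "'a::complex_inner"
  assumes q: "positive_form q"
    and f_def: "\<And>x. f x = q x v / complex_of_real (sqrt (Re (q v v)))"
    and q'_def: "\<And>x y. q' x y = q x y - f x * cnj (f y)"
  shows "clinear_functional f" "positive_form q'" "insert v (radical q) \<subseteq> radical q'"
proof -
  define a where "a = Re (q v v)"
  note D = positive_formD[OF q] positive_form_right[OF q]
  have a0: "0 \<le> a" using D(4) by (simp add: a_def)
  show f: "clinear_functional f"
    by (simp add: clinear_functional_def f_def D(1,2) add_divide_distrib)
  have ff: "f x * cnj (f y) = q x v * cnj (q y v) / complex_of_real a" for x y
  proof -
    have "complex_of_real (sqrt a) * complex_of_real (sqrt a) = complex_of_real a"
      using a0 by (metis of_real_mult real_sqrt_mult_self abs_of_nonneg)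
    then show ?thesis by (simp add: f_def a_def)
  qed
  have "0 \<le> Re (q' x x)" for x
  proof -
    have "Re (f x * cnj (f x)) = (cmod (q x v))\<^sup>2 / a"
      using complex_norm_square[of "q x v"] unfolding ff
      by (metis Re_complex_of_real of_real_divide)
    also have "\<dots> \<le> Re (q x x)"
      using positive_form_Cauchy_Schwarz[OF q, of x v] a0 D(4)[of x]
      by (cases "a = 0") (auto simp: a_def[symmetric] field_simps)
    finally show ?thesis by (simp add: q'_def)
  qed
  moreover have "q' y x = cnj (q' x y)" for x y
    using D(3)[of x y] by (simp add: q'_def)
  moreover have "q' (x + y) z = q' x z + q' y z" "q' (scaleC c x) y = c * q' x y" for c x y z
    using f by (simp_all add: q'_def clinear_functional_def D(1,2) algebra_simps)
  ultimately show "positive_form q'" unfolding positive_form_def by blast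
  have "q' x v = 0" for x
  proof (cases "a = 0")
    case True
    then show ?thesis using positive_form_null[OF q, of v x] by (simp add: q'_def ff a_def)
  next
    case False
    have "q v v = complex_of_real a" unfolding a_def by (rule positive_form_diag[OF q])
    then show ?thesis using False by (simp add: q'_def ff)
  qed
  moreover have "q' x w = 0" if "w \<in> radical q" for x w
  proof -
    have "q v w = 0" "q x w = 0" using that by (auto simp: radical_def)
    moreover have "f w = 0" using \<open>q v w = 0\<close> D(3)[of v w] by (simp add: f_def)
    ultimately show ?thesis by (simp add: q'_def)
  qed
  ultimately show "insert v (radical q) \<subseteq> radical q'" by (auto simp: radical_def)
qed

text \<open>
  Each deflation moves one vector of \<open>S\<close> into the radical; once all of them are there, the radical is
  the whole space and the form is zero.  The count \<open>card S\<close>, rather than the dimension, is where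
  degeneracy of the form saves squares.
\<close>

lemma positive_form_sum_of_squares:
  assumes "finite S" "positive_form q" "cspan (radical q \<union> S) = UNIV"
  shows "\<exists>f. (\<forall>k. clinear_functional (f k)) \<and>
             (\<forall>x y. q x y = (\<Sum>k<card S. f k x * cnj (f k y)))"
  using assms
proof (induction S arbitrary: q rule: finite_induct)
  case empty
  then have "radical q = UNIV"
    using complex_vector.span_eq_iff[of "radical q"] subspace_radical[of q] by simp
  then have "q x y = 0" for x y by (auto simp: radical_def)
  moreover have "clinear_functional (\<lambda>_. 0)" by (simp add: clinear_functional_def)
  ultimately show ?case by (intro exI[of _ "\<lambda>_ _. 0"]) simp
next
  case (insert v S)
  define f where "f x = q x v / complex_of_real (sqrt (Re (q v v)))" for x
  define q' where "q' x y = q x y - f x * cnj (f y)" for x y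
  note defl = positive_form_deflate[OF insert.prems(1) f_def q'_def]
  have "radical q \<union> insert v S \<subseteq> radical q' \<union> S" using defl(3) by auto
  then have "cspan (radical q' \<union> S) = UNIV"
    using insert.prems(2) complex_vector.span_mono by blast
  from insert.IH[OF defl(2) this] obtain h where h: "\<And>k. clinear_functional (h k)"
    "\<And>x y. q' x y = (\<Sum>k<card S. h k x * cnj (h k y))" by blast
  define h' where "h' = h(card S := f)"
  have "q x y = (\<Sum>k<Suc (card S). h' k x * cnj (h' k y))" for x y
    using h(2)[of x y] by (simp add: h'_def q'_def diff_eq_eq)
  moreover have "clinear_functional (h' k)" for k using h(1) defl(1) by (simp add: h'_def)
  ultimately show ?case using insert.hyps by (intro exI[of _ h']) simp
qed

section \<open>Inner product spaces with a finite orthonormal basis\<close>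

lemma positive_form_cinner: "positive_form cinner"
  unfolding positive_form_def
  using cinner_add_left cinner_scaleC_left cinner_commute cinner_ge_zero by blast

lemmas cinner_add_right = positive_form_right(1)[OF positive_form_cinner]
  and cinner_scaleC_right = positive_form_right(2)[OF positive_form_cinner]

lemma cinner_self: "cinner x x = complex_of_real ((norm x)\<^sup>2)"
  using positive_form_diag[OF positive_form_cinner, of x]
  by (simp add: norm_eq_sqrt_cinner cinner_ge_zero)

lemma norm_cinner_le: "cmod (cinner x y) \<le> norm x * norm y"
proof (rule power2_le_imp_le)
  show "(cmod (cinner x y))\<^sup>2 \<le> (norm x * norm y)\<^sup>2"
    using positive_form_Cauchy_Schwarz[OF positive_form_cinner, of x y]
    by (simp add: cinner_self power_mult_distrib)
qed simp

lemma norm_scaleC: "norm (scaleC c x) = cmod c * norm x"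
proof (rule power2_eq_imp_eq)
  have "complex_of_real ((norm (scaleC c x))\<^sup>2) = c * (cnj c * complex_of_real ((norm x)\<^sup>2))"
    unfolding cinner_self[symmetric] by (simp add: cinner_scaleC_left cinner_scaleC_right)
  also have "\<dots> = complex_of_real ((cmod c * norm x)\<^sup>2)"
    by (simp only: power_mult_distrib of_real_mult complex_norm_square[of c] mult.assoc)
  finally show "(norm (scaleC c x))\<^sup>2 = (cmod c * norm x)\<^sup>2"
    using of_real_eq_iff by blast
qed simp_all

lemma bounded_linear_scaleC_left: "bounded_linear (\<lambda>c. scaleC c x)"
proof (rule bounded_linear_intro)
  show "scaleC (r *\<^sub>R c) x = r *\<^sub>R scaleC c x" for r c
    by (simp only: scaleR_conv_of_real[of r c] scaleC_scaleC[of "complex_of_real r" c x, symmetric]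
        scaleC_of_real)
  show "norm (scaleC c x) \<le> norm c * norm x" for c by (simp add: norm_scaleC)
qed (rule scaleC_add_left)

lemma cinner_zero [simp]: "cinner 0 y = 0" "cinner y 0 = 0"
  using cinner_add_left[of 0 0 y] cinner_add_right[of y 0 0] by simp_all

lemma cinner_sum_left: "cinner (\<Sum>i\<in>I. h i) y = (\<Sum>i\<in>I. cinner (h i) y)"
  by (induction I rule: infinite_finite_induct) (simp_all add: cinner_add_left)

lemma cinner_sum_right: "cinner y (\<Sum>i\<in>I. h i) = (\<Sum>i\<in>I. cinner y (h i))"
  by (induction I rule: infinite_finite_induct) (simp_all add: cinner_add_right)

lemma orthonormal_expansion:
  assumes g: "orthonormal_basis n g"
  shows "x = (\<Sum>i\<in>{1..n}. scaleC (cinner x (g i)) (g i))"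
proof -
  let ?E = "\<lambda>x. \<Sum>i\<in>{1..n}. scaleC (cinner x (g i)) (g i)"
  have "complex_vector.subspace {x. x = ?E x}"
  proof (rule complex_vector.subspaceI)
    fix x y :: 'a and c
    show "0 \<in> {x. x = ?E x}" by simp
    assume x: "x \<in> {x. x = ?E x}"
    have "?E (scaleC c x) = scaleC c (?E x)"
      by (simp add: cinner_scaleC_left scaleC_scaleC complex_vector.scale_sum_right)
    then show "scaleC c x \<in> {x. x = ?E x}" using x by simp
    assume y: "y \<in> {x. x = ?E x}"
    have "?E (x + y) = ?E x + ?E y"
      by (simp add: cinner_add_left scaleC_add_left sum.distrib)
    then show "x + y \<in> {x. x = ?E x}" using x y by simp
  qed
  moreover have "g j \<in> {x. x = ?E x}" if j: "j \<in> {1..n}" for j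
  proof -
    have "?E (g j) = (\<Sum>i\<in>{1..n}. if i = j then g i else 0)"
      using g j by (intro sum.cong) (auto simp: orthonormal_basis_def scaleC_one)
    then show ?thesis using j by simp
  qed
  ultimately have "cspan (g ` {1..n}) \<subseteq> {x. x = ?E x}"
    by (intro complex_vector.span_minimal) auto
  then show ?thesis using g unfolding orthonormal_basis_def by blast
qed

lemma clinear_functional_representation:
  fixes f :: "'a::complex_inner \<Rightarrow> complex" and g :: "nat \<Rightarrow> 'a"
  assumes g: "orthonormal_basis n g" and f: "clinear_functional f"
  shows "\<exists>b. \<forall>x. f x = cinner x b"
proof
  have f0: "f 0 = 0" using f unfolding clinear_functional_def by (metis add_cancel_left_left)
  have fsum: "f (\<Sum>i\<in>I. h i) = (\<Sum>i\<in>I. f (h i))" for I :: "nat set" and h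
    using f f0 by (induction I rule: infinite_finite_induct) (auto simp: clinear_functional_def)
  show "\<forall>x. f x = cinner x (\<Sum>i\<in>{1..n}. scaleC (cnj (f (g i))) (g i))"
  proof
    fix x
    have "f x = (\<Sum>i\<in>{1..n}. f (scaleC (cinner x (g i)) (g i)))"
      using orthonormal_expansion[OF g, of x] fsum by metis
    also have "\<dots> = cinner x (\<Sum>i\<in>{1..n}. scaleC (cnj (f (g i))) (g i))"
      using f by (simp add: clinear_functional_def cinner_sum_right cinner_scaleC_right mult.commute)
    finally show "f x = cinner x (\<Sum>i\<in>{1..n}. scaleC (cnj (f (g i))) (g i))" .
  qed
qed

text \<open>The disc is a closed subset of the continuous image of a square.\<close>

lemma compact_complex_unit_disc: "compact (cball (0::complex) 1)"
proof -
  let ?Q = "(\<lambda>p. complex_of_real (fst p) + \<i> * complex_of_real (snd p)) ` ({-1..1} \<times> {-1..1})"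
  have "z \<in> ?Q" if "z \<in> cball 0 1" for z
  proof -
    have "\<bar>Re z\<bar> \<le> 1" "\<bar>Im z\<bar> \<le> 1"
      using that abs_Re_le_cmod[of z] abs_Im_le_cmod[of z] by simp_all
    then show ?thesis by (intro image_eqI[of _ _ "(Re z, Im z)"]) (auto simp: complex_eq_iff)
  qed
  then have "cball 0 1 = ?Q \<inter> cball 0 1" by blast
  moreover have "compact (?Q \<inter> cball 0 1)"
    by (intro compact_Int_closed compact_continuous_image compact_Times continuous_intros
        compact_Icc closed_cball)
  ultimately show ?thesis by simp
qed

text \<open>
  The box is the finite Minkowski sum of the discs \<open>{c g\<^sub>i | \<bar>c\<bar> \<le> 1}\<close>, so compactness passes from
  the complex unit disc to it one summand at a time.
\<close>

lemma compact_coefficient_box: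
  fixes g :: "nat \<Rightarrow> 'a::complex_inner"
  assumes "finite I"
  shows "compact {\<Sum>i\<in>I. scaleC (c i) (g i) | c. \<forall>i\<in>I. cmod (c i) \<le> 1}"
  using assms
proof (induction I rule: finite_induct)
  case empty
  show ?case by simp
next
  case (insert j I)
  let ?K = "\<lambda>I. {\<Sum>i\<in>I. scaleC (c i) (g i) | c. \<forall>i\<in>I. cmod (c i) \<le> 1}"
  let ?D = "(\<lambda>c. scaleC c (g j)) ` cball 0 1"
  have "?K (insert j I) = {x + y | x y. x \<in> ?D \<and> y \<in> ?K I}"
  proof (intro equalityI subsetI)
    fix z assume "z \<in> ?K (insert j I)"
    then obtain c where "z = scaleC (c j) (g j) + (\<Sum>i\<in>I. scaleC (c i) (g i))"
      "cmod (c j) \<le> 1" "\<forall>i\<in>I. cmod (c i) \<le> 1"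
      using insert.hyps by auto
    moreover from this have "scaleC (c j) (g j) \<in> ?D" by (intro imageI) simp
    ultimately show "z \<in> {x + y | x y. x \<in> ?D \<and> y \<in> ?K I}" by blast
  next
    fix z assume "z \<in> {x + y | x y. x \<in> ?D \<and> y \<in> ?K I}"
    then obtain a c where ac: "z = scaleC a (g j) + (\<Sum>i\<in>I. scaleC (c i) (g i))"
      "cmod a \<le> 1" "\<forall>i\<in>I. cmod (c i) \<le> 1" by auto
    have "(\<Sum>i\<in>I. scaleC ((c(j := a)) i) (g i)) = (\<Sum>i\<in>I. scaleC (c i) (g i))"
      using insert.hyps by (intro sum.cong) auto
    then have "z = (\<Sum>i\<in>insert j I. scaleC ((c(j := a)) i) (g i))"
      using ac(1) insert.hyps by simp
    moreover have "\<forall>i\<in>insert j I. cmod ((c(j := a)) i) \<le> 1" using ac by auto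
    ultimately show "z \<in> ?K (insert j I)" by blast
  qed
  moreover have "compact ?D"
    by (intro compact_continuous_image bounded_linear.continuous_on[OF bounded_linear_scaleC_left]
        continuous_on_id compact_complex_unit_disc)
  moreover have "{x + y | x y. x \<in> ?D \<and> y \<in> ?K I} = (\<lambda>p. fst p + snd p) ` (?D \<times> ?K I)"
    by (intro equalityI subsetI) (force simp del: mem_Collect_eq, force)
  moreover have "compact ((\<lambda>p. fst p + snd p) ` (?D \<times> ?K I))"
    by (intro compact_continuous_image compact_Times continuous_intros insert.IH \<open>compact ?D\<close>)
  ultimately show ?case by simp
qed

text \<open>
  The coefficients of a unit vector in an orthonormal basis have modulus at most one, so the sphere
  is a closed subset of the coefficient box.
\<close>

lemma compact_unit_sphere:
  fixes g :: "nat \<Rightarrow> 'a::complex_inner"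
  assumes g: "orthonormal_basis n g"
  shows "compact (sphere (0::'a) 1)"
proof -
  let ?K = "{\<Sum>i\<in>{1..n}. scaleC (c i) (g i) | c. \<forall>i\<in>{1..n}. cmod (c i) \<le> 1}"
  have "x \<in> ?K" if "x \<in> sphere 0 1" for x
  proof -
    have "cmod (cinner x (g i)) \<le> 1" if i: "i \<in> {1..n}" for i
    proof -
      have "complex_of_real ((norm (g i))\<^sup>2) = 1"
        using g i unfolding cinner_self[symmetric] orthonormal_basis_def by auto
      then have "(norm (g i))\<^sup>2 = 1" using of_real_eq_1_iff by blast
      then have "norm (g i) = 1" by (simp add: power2_eq_1_iff) (metis norm_ge_zero not_one_le_zero neg_0_le_iff_le)
      then show ?thesis using norm_cinner_le[of x "g i"] \<open>x \<in> sphere 0 1\<close> by simp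
    qed
    then have "\<exists>c. x = (\<Sum>i\<in>{1..n}. scaleC (c i) (g i)) \<and> (\<forall>i\<in>{1..n}. cmod (c i) \<le> 1)"
      using orthonormal_expansion[OF g, of x] by (intro exI[of _ "\<lambda>i. cinner x (g i)"]) blast
    then show ?thesis by blast
  qed
  then have "sphere 0 1 = ?K \<inter> sphere 0 1" by blast
  moreover have "closed (sphere (0::'a) 1)"
    unfolding sphere_def by (intro closed_Collect_eq continuous_intros)
  then have "compact (?K \<inter> sphere 0 1)"
    by (intro compact_Int_closed compact_coefficient_box) simp_all
  ultimately show ?thesis by simp
qed

text \<open>
  The condition \<open>onorm T \<noteq> 0\<close> excludes the zero space, which has no unit vectors.
\<close>

lemma onorm_attained:
  fixes T :: "'a::complex_inner \<Rightarrow> 'b::real_normed_vector" and g :: "nat \<Rightarrow> 'a"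
  assumes g: "orthonormal_basis n g" and T: "bounded_linear T" and nz: "onorm T \<noteq> 0"
  obtains x where "norm x = 1" "norm (T x) = onorm T"
proof -
  interpret bounded_linear T by (rule T)
  have ne: "sphere (0::'a) 1 \<noteq> {}"
  proof -
    obtain x where "T x \<noteq> 0" using nz onorm_eq_0[OF T] by blast
    then have "x \<noteq> 0" using zero by auto
    then have "x /\<^sub>R norm x \<in> sphere 0 1" by simp
    then show ?thesis by blast
  qed
  have "continuous_on (sphere 0 1) (\<lambda>x. norm (T x))"
    by (intro continuous_on_norm continuous_on continuous_on_id)
  from continuous_attains_sup[OF compact_unit_sphere[OF g] ne this]
  obtain x where x: "norm x = 1" "\<And>y. norm y = 1 \<Longrightarrow> norm (T y) \<le> norm (T x)"
    by auto
  have "norm (T z) \<le> norm (T x) * norm z" for z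
  proof (cases "z = 0")
    case False
    then have "norm (T (z /\<^sub>R norm z)) \<le> norm (T x)" by (intro x(2)) simp
    then show ?thesis using False by (simp add: scaleR field_simps)
  qed (simp add: zero)
  then have "onorm T \<le> norm (T x)" by (intro onorm_bound norm_ge_zero)
  moreover have "norm (T x) \<le> onorm T" using onorm[OF T, of x] x(1) by simp
  ultimately show thesis using that x(1) by force
qed

section \<open>Dilating a Parseval frame to an orthonormal basis\<close>

text \<open>
  This is the finite-dimensional Naimark dilation theorem.  In the proof \<open>J\<close> is the analysis map of
  the frame and \<open>R\<close> the synthesis map, which is its adjoint; the Parseval identity says that
  \<open>R\<close> is a left inverse of \<open>J\<close>, hence \<open>J \<circ> R\<close> is the projection onto the range of \<open>J\<close>.
  The index shift reconciles the numbering of basis vectors from one with that of coordinates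
  from zero.
\<close>

lemma Parseval_frame_dilation:
  fixes u :: "nat \<Rightarrow> 'h::complex_inner"
  assumes frame: "\<And>x y. (\<Sum>k<M. cinner x (u k) * cinner (u k) y) = cinner x y"
  shows "\<exists>(J :: 'h \<Rightarrow> complex vec) e P.
           isometric_embedding M J \<and> orthonormal_basis_l2 M e \<and>
           orthogonal_projection M (range J) P \<and> (\<forall>k<M. P (e (Suc k)) = J (u k))"
proof -
  define J where "J x = vec M (\<lambda>k. cinner x (u k))" for x
  define R where "R v = (\<Sum>k<M. scaleC (v $ k) (u k))" for v :: "complex vec"
  define e where "e i = (unit_vec M (i - 1) :: complex vec)" for i
  have J_carrier: "J x \<in> carrier_vec M" for x by (simp add: J_def)
  have sprod: "v \<bullet>c J y = cinner (R v) y" if "v \<in> carrier_vec M" for v y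
    using that
    by (simp add: scalar_prod_def J_def R_def cinner_sum_left cinner_scaleC_left
        cinner_commute[of y] lessThan_atLeast0)
  have RJ: "cinner (R (J x)) y = cinner x y" for x y
    unfolding frame[of x y, symmetric]
    by (simp add: R_def J_def cinner_sum_left cinner_scaleC_left)
  have "isometric_embedding M J"
    unfolding isometric_embedding_def
  proof (intro conjI allI)
    fix x y c
    show "J (x + y) = J x + J y" by (auto simp: J_def cinner_add_left)
    show "J (scaleC c x) = c \<cdot>\<^sub>v J x" by (auto simp: J_def cinner_scaleC_left)
    show "J x \<bullet>c J y = cinner x y" by (simp add: sprod J_carrier RJ)
  qed (rule J_carrier)
  moreover have "orthonormal_basis_l2 M e"
    unfolding orthonormal_basis_l2_def
  proof (intro conjI ballI)
    fix i j assume "i \<in> {1..M}" "j \<in> {1..M}"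
    moreover have "conjugate (e j) = e j" by (auto simp: e_def unit_vec_def)
    ultimately show "e i \<bullet>c e j = (if i = j then 1 else 0)"
      unfolding e_def by (auto simp: scalar_prod_left_unit[OF unit_vec_carrier])
  next
    interpret vec_space "TYPE(complex)" M .
    have "(\<lambda>i. i - 1) ` {1..M} = {0..<M}"
      by (force simp: image_iff intro: bexI[of _ "Suc _"])
    then have "e ` {1..M} = set (unit_vecs M)"
      unfolding e_def unit_vecs_def set_map by (metis image_image set_upt)
    then show "vectorspace.basis class_ring (module_vec TYPE(complex) M) (e ` {1..M})"
      using unit_vecs_basis by simp
  qed
  moreover have "orthogonal_projection M (range J) (\<lambda>v. J (R v))"
    unfolding orthogonal_projection_def
  proof (intro ballI conjI)
    fix v w :: "complex vec"
    assume v: "v \<in> carrier_vec M" and "w \<in> range J"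
    then obtain y where y: "w = J y" by blast
    have "(v - J (R v)) \<bullet>c J y = v \<bullet>c J y - J (R v) \<bullet>c J y"
      using v J_carrier by (intro minus_scalar_prod_distrib) auto
    then show "(v - J (R v)) \<bullet>c w = 0" using v by (simp add: y sprod J_carrier RJ)
  qed simp
  moreover have "J (R (e (Suc k))) = J (u k)" if k: "k < M" for k
  proof -
    have "R (e (Suc k)) = (\<Sum>l<M. if l = k then u l else 0)"
      unfolding R_def e_def using k by (intro sum.cong) (auto simp: scaleC_one)
    then show ?thesis using k by simp
  qed
  ultimately show ?thesis by blast
qed

section \<open>Completing the images of a basis to a Parseval frame\<close>

text \<open>
  The vectors \<open>b\<close> come from the defect form \<open>q(x, y) = \<langle>x, y\<rangle> - \<langle>S x, S y\<rangle>\<close>, where \<open>S\<close> is the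
  adjoint of \<open>T\<close>: its radical contains \<open>T x\<close> for any unit vector \<open>x\<close> at which \<open>T\<close> attains its
  norm, so one basis vector needs no square.
\<close>

lemma norm_one_defect_sum_of_squares:
  fixes T :: "'h::complex_inner \<Rightarrow> 'h" and g :: "nat \<Rightarrow> 'h"
  assumes g: "orthonormal_basis n g" and T: "bounded_clinear T" and norm_T: "onorm T = 1"
  shows "\<exists>b. \<forall>x y. cinner x y = (\<Sum>i\<in>{1..n}. cinner x (T (g i)) * cinner (T (g i)) y) +
                     (\<Sum>k<cdim (UNIV :: 'h set) - 1. cinner x (b k) * cinner (b k) y)"
proof -
  have bl: "bounded_linear T" and T_scaleC: "\<And>c x. T (scaleC c x) = scaleC c (T x)"
    using T by (auto simp: bounded_clinear_def)
  have T_le: "norm (T x) \<le> norm x" for x using onorm[OF bl, of x] norm_T by simp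
  define S where "S x = (\<Sum>i\<in>{1..n}. scaleC (cinner x (T (g i))) (g i))" for x
  have adj: "cinner z (T x) = cinner (S z) x" for z x
  proof -
    have "T x = T (\<Sum>i\<in>{1..n}. scaleC (cinner x (g i)) (g i))"
      using orthonormal_expansion[OF g, of x] by simp
    also have "\<dots> = (\<Sum>i\<in>{1..n}. scaleC (cinner x (g i)) (T (g i)))"
      by (simp add: linear_sum[OF bounded_linear.linear[OF bl]] T_scaleC)
    finally show ?thesis
      by (simp add: S_def cinner_sum_left cinner_sum_right cinner_scaleC_left
          cinner_scaleC_right cinner_commute[of x] mult.commute)
  qed
  \<comment> \<open>A contraction has a contractive adjoint, which is positivity of the defect form.\<close>
  have S_le: "norm (S x) \<le> norm x" for x
  proof -
    have "complex_of_real ((norm (S x))\<^sup>2) = cinner x (T (S x))"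
      unfolding cinner_self[symmetric] adj by (rule refl)
    then have "(norm (S x))\<^sup>2 \<le> norm x * norm (T (S x))"
      using norm_cinner_le[of x "T (S x)"]
      by (metis norm_of_real abs_of_nonneg zero_le_power2)
    also have "\<dots> \<le> norm x * norm (S x)" by (intro mult_left_mono T_le) simp
    finally show ?thesis
      by (cases "norm (S x) = 0") (simp_all add: power2_eq_square)
  qed
  define q where "q x y = cinner x y - cinner (S x) (S y)" for x y
  have S_lin: "S (x + y) = S x + S y" "S (scaleC c x) = scaleC c (S x)" for x y c
    by (simp_all add: S_def cinner_add_left scaleC_add_left sum.distrib cinner_scaleC_left
        complex_vector.scale_sum_right scaleC_scaleC)
  have q_diag: "Re (q x x) = (norm x)\<^sup>2 - (norm (S x))\<^sup>2" for x
    by (simp add: q_def cinner_self flip: of_real_power)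
  have "0 \<le> Re (q x x)" for x unfolding q_diag using S_le[of x] by (simp add: power_mono)
  moreover have "q y x = cnj (q x y)" for x y
    unfolding q_def by (metis cinner_commute complex_cnj_diff)
  moreover have "q (x + y) z = q x z + q y z" "q (scaleC c x) y = c * q x y" for c x y z
    by (simp_all add: q_def S_lin cinner_add_left cinner_scaleC_left algebra_simps)
  ultimately have q: "positive_form q" unfolding positive_form_def by blast

  obtain x where x: "norm x = 1" "norm (T x) = 1"
    using onorm_attained[OF g bl] norm_T by auto
  have "cinner (S (T x)) x = 1" using adj[of "T x" x] x cinner_self[of "T x"] by simp
  then have "1 \<le> norm (S (T x))" using norm_cinner_le[of "S (T x)" x] x by simp
  then have "Re (q (T x) (T x)) \<le> 0" using x power_mono[of 1 "norm (S (T x))" 2] by (simp add: q_diag)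
  then have Tx_rad: "T x \<in> radical q" using positive_form_null[OF q] by (simp add: radical_def)
  have "T x \<noteq> 0" using x by auto

  \<comment> \<open>Extend the null vector to a basis; its other members span a complement of the null line.\<close>
  have "complex_vector.independent {T x}" using \<open>T x \<noteq> 0\<close> by simp
  then obtain B where B: "{T x} \<subseteq> B" "B \<subseteq> insert (T x) (g ` {1..n})"
      "complex_vector.independent B" "insert (T x) (g ` {1..n}) \<subseteq> cspan B"
    using complex_vector.maximal_independent_subset_extend
      [of "{T x}" "insert (T x) (g ` {1..n})"] by blast
  have "cspan (g ` {1..n}) \<subseteq> cspan B" using B(4) by (intro complex_vector.span_minimal) auto
  then have span_B: "cspan B = UNIV" using g by (auto simp: orthonormal_basis_def)
  have finB: "finite B" using B(2) by (rule finite_subset) simp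
  have "card B = cdim (UNIV :: 'h set)"
    using complex_vector.dim_eq_card[of B UNIV] span_B B(3) by simp
  then have card: "card (B - {T x}) = cdim (UNIV :: 'h set) - 1"
    using B(1) finB by simp
  have "B \<subseteq> radical q \<union> (B - {T x})" using Tx_rad by auto
  then have "cspan (radical q \<union> (B - {T x})) = UNIV"
    using span_B complex_vector.span_mono by blast
  then obtain f where f: "\<And>k. clinear_functional (f k)"
    "\<And>x y. q x y = (\<Sum>k<cdim (UNIV :: 'h set) - 1. f k x * cnj (f k y))"
    using positive_form_sum_of_squares[OF _ q, of "B - {T x}"] finB card by auto
  obtain b where b: "\<And>k x. f k x = cinner x (b k)"
    using clinear_functional_representation[OF g f(1)] by metis
  have "cinner (S x) (S y) = (\<Sum>i\<in>{1..n}. cinner x (T (g i)) * cinner (T (g i)) y)" for x y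
  proof -
    have "cinner (S x) (S y) = cnj (cinner y (T (S x)))"
      using cinner_commute[of "S x" "S y"] by (simp add: adj)
    also have "\<dots> = cinner (T (S x)) y" using cinner_commute[of "T (S x)" y] by simp
    also have "T (S x) = (\<Sum>i\<in>{1..n}. scaleC (cinner x (T (g i))) (T (g i)))"
      by (simp add: S_def linear_sum[OF bounded_linear.linear[OF bl]] T_scaleC)
    finally show ?thesis by (simp add: cinner_sum_left cinner_scaleC_left)
  qed
  then have split: "cinner x y = (\<Sum>i\<in>{1..n}. cinner x (T (g i)) * cinner (T (g i)) y) + q x y"
    for x y by (simp add: q_def)
  have "q x y = (\<Sum>k<cdim (UNIV :: 'h set) - 1. cinner x (b k) * cinner (b k) y)" for x y
    unfolding f(2) b by (simp add: cinner_commute[of "b _" y])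
  then show ?thesis
    by (intro exI[of _ b] allI) (rule trans[OF split arg_cong[of _ _ "(+) _"]])
qed

theorem theorem3p5:
  fixes T :: "'h::complex_hilbert_space \<Rightarrow> 'h"
    and g :: "nat \<Rightarrow> 'h"
    and n M :: nat
  assumes "cdim (UNIV :: 'h set) = n"
    and "orthonormal_basis n g"
    and "bounded_clinear T"
    and "onorm T = 1"
    and "M = 2 * n - 1"
  shows "\<exists>(J :: 'h \<Rightarrow> complex vec) (e :: nat \<Rightarrow> complex vec) P.
           isometric_embedding M J \<and>
           orthonormal_basis_l2 M e \<and>
           orthogonal_projection M (range J) P \<and>
           (\<forall>i\<in>{1..n}. P (e i) = J (T (g i)))"
proof -
  obtain b where b: "\<And>x y. cinner x y = (\<Sum>i\<in>{1..n}. cinner x (T (g i)) * cinner (T (g i)) y) +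
      (\<Sum>k<n - 1. cinner x (b k) * cinner (b k) y)"
    using norm_one_defect_sum_of_squares[OF assms(2-4)] unfolding assms(1) by blast
  define u where "u k = (if k < n then T (g (Suc k)) else b (k - n))" for k
  \<comment> \<open>For \<open>n = 0\<close> this holds because both truncated differences are zero.\<close>
  have M: "M = n + (n - 1)" using assms(5) by simp
  have "(\<Sum>k<M. cinner x (u k) * cinner (u k) y) = cinner x y" for x y
  proof -
    let ?h = "\<lambda>v. cinner x v * cinner v y"
    have "(\<Sum>k<M. ?h (u k)) = (\<Sum>k<n. ?h (u k)) + (\<Sum>k<n - 1. ?h (u (n + k)))"
      using sum.atLeastLessThan_concat[of 0 n M "\<lambda>k. ?h (u k)"]
        sum.shift_bounds_nat_ivl[of "\<lambda>k. ?h (u k)" 0 n "n - 1"]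
      by (simp add: M lessThan_atLeast0 add.commute)
    also have "(\<Sum>k<n. ?h (u k)) = (\<Sum>i\<in>{1..n}. ?h (T (g i)))"
      by (rule sum.reindex_bij_witness[of _ "\<lambda>i. i - 1" Suc]) (auto simp: u_def)
    also have "(\<Sum>k<n - 1. ?h (u (n + k))) = (\<Sum>k<n - 1. ?h (b k))"
      by (simp add: u_def)
    finally show ?thesis using b[of x y] by simp
  qed
  from Parseval_frame_dilation[OF this] obtain J :: "'h \<Rightarrow> complex vec" and e P
    where JeP: "isometric_embedding M J" "orthonormal_basis_l2 M e"
      "orthogonal_projection M (range J) P" "\<And>k. k < M \<Longrightarrow> P (e (Suc k)) = J (u k)"
    by blast
  have "P (e i) = J (T (g i))" if i: "i \<in> {1..n}" for i
    using JeP(4)[of "i - 1"] i M by (auto simp: u_def)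
  with JeP show ?thesis by blast
qed

end
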